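(* The degree zero part $S'(2,0)_{\deg=0}$ of the $\mathbb{Z}$-grading $\deg$ of $S'(2,0)$ is isomorphic, as a Lie superalgebra, to the Lie superalgebra $\mathcal{S}=\langle\triangle,L,H,\Lambda,d,d^*,d_c,d_c^*\rangle$ of classical operators in Kähler geometry.
   Context: The superalgebra $S'(2,0)$. Let $W(2)$ be the Lie superalgebra of all derivations of $\mathbb{C}[t,t^{-1}]\otimes\Lambda(2)$, where $\Lambda(2)$ is the Grassmann algebra in odd variables $\theta_1,\theta_2$ and $t$ is even. Put $\mathrm{Div}(f\partial_t+f_1\partial_1+f_2\partial_2)=\partial_tf+\sum_i(-1)^{p(f_i)}\partial_if_i$, $S(2,0)=\{D\in W(2)\mid\mathrm{Div}D=0\}$, $S'(2,0)=[S(2,0),S(2,0)]$. A basis of $S'(2,0)$ is ($n\in\mathbb{Z}$): $\mathcal{L}_n=-t^n(t\partial_t+\frac12(n+1)(\theta_1\partial_1+\theta_2\partial_2))$, $E_n=t^n\theta_2\partial_1$, $H_n=t^n(\theta_2\partial_2-\theta_1\partial_1)$, $F_n=t^n\theta_1\partial_2$, $h_n=t^n\theta_2\partial_t-nt^{n-1}\theta_1\theta_2\partial_1$, $p_n=-t^{n+1}\partial_2$, $x_n=t^{n+1}\partial_1$, $y_n=t^n\theta_1\partial_t+nt^{n-1}\theta_1\theta_2\partial_2$. The grading $\deg$ is defined by the element $L_0=-\mathcal{L}_0+\frac12H_0$: $[L_0,s]=(\deg s)s$ for homogeneous $s$. Explicitly, $\deg\mathcal{L}_n=\deg H_n=\deg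 h_n=\deg p_n=n$, $\deg E_n=\deg x_n=n+1$, $\deg F_n=\deg y_n=n-1$. The Lie superalgebra $\mathcal{S}$ of classical operators on differential forms on a compact Kähler manifold: it has basis $\triangle,L,H,\Lambda$ (even; the Laplacian $\triangle=dd^*+d^*d$, multiplication $L$ by the Kähler form, $\Lambda=L^*$, and $H=[L,\Lambda]$) and $d,d^*,d_c,d_c^*$ (odd; $d=\partial+\bar\partial$, $d_c=i(\partial-\bar\partial)$ and their adjoints), with non-vanishing (super)commutation relations $[L,\Lambda]=H$, $[H,L]=2L$, $[H,\Lambda]=-2\Lambda$, $[d,d^*]=\triangle$, $[d_c,d_c^*]=\triangle$, $[H,d]=d$, $[H,d^*]=-d^*$, $[H,d_c]=d_c$, $[H,d_c^*]=-d_c^*$, $[L,d^*]=-d_c$, $[L,d_c^*]=d$, $[\Lambda,d]=d_c^*$, $[\Lambda,d_c]=-d^*$. It is regarded as the 8-dimensional complex Lie superalgebra with this basis and these relations. *)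

theory Defs
  imports
    "HOL-Analysis.Cartesian_Space"
    "HOL-Library.Poly_Mapping"
    "HOL-Library.Function_Algebras"
    "HOL-Library.Z2"
begin

section \<open>Complex Lie superalgebras\<close>

text \<open>
  A Lie superalgebra is given by its two homogeneous parts, indexed by \<open>\<int>/2\<close> (the type
  \<^typ>\<open>bit\<close>), inside an ambient complex vector space. Only the values of the bracket on
  the carrier matter.
\<close>

record 'a super_lie =
  part :: "bit \<Rightarrow> 'a set"
  scal :: "complex \<Rightarrow> 'a \<Rightarrow> 'a"
  br :: "'a \<Rightarrow> 'a \<Rightarrow> 'a"

definition carr :: "('a::ab_group_add, 'm) super_lie_scheme \<Rightarrow> 'a set" where
  "carr g = {x + y | x y. x \<in> part g 0 \<and> y \<in> part g 1}"

definition koszul :: "bit \<Rightarrow> bit \<Rightarrow> 'b::ring_1" where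
  \<comment> \<open>the sign \<open>(-1)\<^bsup>pq\<^esup>\<close>\<close>
  "koszul p q = (if p = 1 \<and> q = 1 then - 1 else 1)"

locale lie_superalgebra =
  fixes g :: "('a::ab_group_add, 'm) super_lie_scheme"
  assumes vector_space: "vector_space (scal g)"
    and subspace_part: "module.subspace (scal g) (part g p)"
    and part_Int: "part g 0 \<inter> part g 1 = {0}"
    and br_closed: "\<lbrakk>x \<in> part g p; y \<in> part g q\<rbrakk> \<Longrightarrow> br g x y \<in> part g (p + q)"
    and br_add_left: "\<lbrakk>x \<in> carr g; y \<in> carr g; z \<in> carr g\<rbrakk>
      \<Longrightarrow> br g (x + y) z = br g x z + br g y z"
    and br_add_right: "\<lbrakk>x \<in> carr g; y \<in> carr g; z \<in> carr g\<rbrakk>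
      \<Longrightarrow> br g x (y + z) = br g x y + br g x z"
    and br_scal_left: "\<lbrakk>x \<in> carr g; y \<in> carr g\<rbrakk>
      \<Longrightarrow> br g (scal g c x) y = scal g c (br g x y)"
    and br_scal_right: "\<lbrakk>x \<in> carr g; y \<in> carr g\<rbrakk>
      \<Longrightarrow> br g x (scal g c y) = scal g c (br g x y)"
    and super_skew: "\<lbrakk>x \<in> part g p; y \<in> part g q\<rbrakk>
      \<Longrightarrow> br g x y = - scal g (koszul p q) (br g y x)"
    and super_jacobi: "\<lbrakk>x \<in> part g p; y \<in> part g q; z \<in> part g r\<rbrakk>
      \<Longrightarrow> br g x (br g y z)
        = br g (br g x y) z + scal g (koszul p q) (br g y (br g x z))"

definition super_lie_iso ::
  "('a::ab_group_add \<Rightarrow> 'b::ab_group_add)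
    \<Rightarrow> ('a, 'm) super_lie_scheme \<Rightarrow> ('b, 'n) super_lie_scheme \<Rightarrow> bool" where
  "super_lie_iso \<phi> g h \<longleftrightarrow>
     bij_betw \<phi> (carr g) (carr h) \<and>
     (\<forall>p. \<phi> ` part g p = part h p) \<and>
     (\<forall>x\<in>carr g. \<forall>y\<in>carr g. \<phi> (x + y) = \<phi> x + \<phi> y) \<and>
     (\<forall>c. \<forall>x\<in>carr g. \<phi> (scal g c x) = scal h c (\<phi> x)) \<and>
     (\<forall>x\<in>carr g. \<forall>y\<in>carr g. \<phi> (br g x y) = br h (\<phi> x) (\<phi> y))"

definition isomorphic_lie_superalgebras ::
  "('a::ab_group_add, 'm) super_lie_scheme \<Rightarrow> ('b::ab_group_add, 'n) super_lie_scheme \<Rightarrow> bool"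
  where
  "isomorphic_lie_superalgebras g h \<longleftrightarrow>
     lie_superalgebra g \<and> lie_superalgebra h \<and> (\<exists>\<phi>. super_lie_iso \<phi> g h)"

definition sub_super_lie ::
  "('a, 'm) super_lie_scheme \<Rightarrow> 'a set \<Rightarrow> ('a, 'm) super_lie_scheme" where
  \<comment> \<open>meaningful for \<open>X\<close> a graded subspace closed under the bracket\<close>
  "sub_super_lie g X = g\<lparr>part := \<lambda>p. part g p \<inter> X\<rparr>"

definition derived_super_lie ::
  "('a::ab_group_add, 'm) super_lie_scheme \<Rightarrow> ('a, 'm) super_lie_scheme" where
  "derived_super_lie g =
     sub_super_lie g (module.span (scal g) {br g x y | x y. x \<in> carr g \<and> y \<in> carr g})"

definition degree_part ::
  "('a::ab_group_add, 'm) super_lie_scheme \<Rightarrow> 'a \<Rightarrow> int \<Rightarrow> ('a, 'm) super_lie_scheme" where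
  \<comment> \<open>the degree \<open>k\<close> part of the grading defined by the element \<open>l\<close>\<close>
  "degree_part g l k = sub_super_lie g {s. br g l s = scal g (of_int k) s}"


section \<open>The superalgebra \<open>\<complex>[t,t\<^sup>-\<^sup>1] \<otimes> \<Lambda>(2)\<close>\<close>

text \<open>
  The convolution product makes \<^typ>\<open>int \<Rightarrow>\<^sub>0 complex\<close> the ring of Laurent polynomials.
  \<open>SL a b c d\<close> stands for \<open>a + b \<theta>\<^sub>1 + c \<theta>\<^sub>2 + d \<theta>\<^sub>1\<theta>\<^sub>2\<close>.
\<close>

type_synonym laurent = "int \<Rightarrow>\<^sub>0 complex"

datatype superlaurent = SL (c0: laurent) (c1: laurent) (c2: laurent) (c12: laurent)

instantiation superlaurent :: ring_1
begin

definition "0 = SL 0 0 0 0"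
definition "1 = SL 1 0 0 0"
definition "a + b = SL (c0 a + c0 b) (c1 a + c1 b) (c2 a + c2 b) (c12 a + c12 b)"
definition "- a = SL (- c0 a) (- c1 a) (- c2 a) (- c12 a)"
definition "a - b = SL (c0 a - c0 b) (c1 a - c1 b) (c2 a - c2 b) (c12 a - c12 b)"
definition "a * b = SL
  (c0 a * c0 b)
  (c0 a * c1 b + c1 a * c0 b)
  (c0 a * c2 b + c2 a * c0 b)
  (c0 a * c12 b + c12 a * c0 b + c1 a * c2 b - c2 a * c1 b)"

instance
  by standard
    (simp_all add: zero_superlaurent_def one_superlaurent_def plus_superlaurent_def
      uminus_superlaurent_def minus_superlaurent_def times_superlaurent_def algebra_simps)

end

definition tpow :: "int \<Rightarrow> superlaurent" where
  "tpow n = SL (Poly_Mapping.single n 1) 0 0 0"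

definition theta1 :: superlaurent where "theta1 = SL 0 1 0 0"

definition theta2 :: superlaurent where "theta2 = SL 0 0 1 0"

definition const :: "complex \<Rightarrow> superlaurent" where
  "const c = SL (Poly_Mapping.single 0 c) 0 0 0"

lemma superlaurent_relations:
  "tpow m * tpow n = tpow (m + n)" "tpow 0 = 1"
  "tpow n * theta1 = theta1 * tpow n" "tpow n * theta2 = theta2 * tpow n"
  "theta1 * theta1 = 0" "theta2 * theta2 = 0" "theta1 * theta2 = - (theta2 * theta1)"
  "theta1 * theta2 = SL 0 0 0 1" "const c * a = a * const c"
  by (simp_all add: tpow_def theta1_def theta2_def const_def zero_superlaurent_def
      one_superlaurent_def uminus_superlaurent_def times_superlaurent_def
      Poly_Mapping.mult_single mult.commute)

definition sl_part :: "bit \<Rightarrow> superlaurent set" where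
  "sl_part p = (if p = 0 then {SL a 0 0 d | a d. True} else {SL 0 b c 0 | b c. True})"

definition sl_proj :: "bit \<Rightarrow> superlaurent \<Rightarrow> superlaurent" where
  "sl_proj p a = (if p = 0 then SL (c0 a) 0 0 (c12 a) else SL 0 (c1 a) (c2 a) 0)"

definition sl_sign :: "superlaurent \<Rightarrow> superlaurent" where
  \<comment> \<open>linear extension of \<open>f \<mapsto> (-1)\<^bsup>p(f)\<^esup> f\<close>\<close>
  "sl_sign a = sl_proj 0 a - sl_proj 1 a"

definition laurent_deriv :: "laurent \<Rightarrow> laurent" where
  "laurent_deriv f =
     (\<Sum>n\<in>Poly_Mapping.keys f.
        Poly_Mapping.single (n - 1) (of_int n * Poly_Mapping.lookup f n))"

definition d_t :: "superlaurent \<Rightarrow> superlaurent" where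
  "d_t a = SL (laurent_deriv (c0 a)) (laurent_deriv (c1 a))
              (laurent_deriv (c2 a)) (laurent_deriv (c12 a))"

text \<open>Left derivatives: \<open>\<partial>\<^sub>1(\<theta>\<^sub>1\<theta>\<^sub>2) = \<theta>\<^sub>2\<close> and \<open>\<partial>\<^sub>2(\<theta>\<^sub>1\<theta>\<^sub>2) = -\<theta>\<^sub>1\<close>.\<close>

definition d_1 :: "superlaurent \<Rightarrow> superlaurent" where
  "d_1 a = SL (c1 a) 0 (c12 a) 0"

definition d_2 :: "superlaurent \<Rightarrow> superlaurent" where
  "d_2 a = SL (c2 a) (- c12 a) 0 0"


section \<open>\<open>W(2)\<close>, \<open>S(2,0)\<close> and \<open>S'(2,0)\<close>\<close>

type_synonym operator = "superlaurent \<Rightarrow> superlaurent"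

definition op_scal :: "complex \<Rightarrow> operator \<Rightarrow> operator" where
  "op_scal c D = (\<lambda>a. const c * D a)"

definition superderivations :: "bit \<Rightarrow> operator set" where
  \<comment> \<open>the homogeneous complex-linear superderivations of parity \<open>p\<close>\<close>
  "superderivations p = {D.
     (\<forall>a b. D (a + b) = D a + D b) \<and>
     (\<forall>c a. D (const c * a) = const c * D a) \<and>
     (\<forall>q. \<forall>a\<in>sl_part q. D a \<in> sl_part (p + q)) \<and>
     (\<forall>q. \<forall>a\<in>sl_part q. \<forall>b. D (a * b) = D a * b + koszul p q * (a * D b))}"

definition op_comp :: "bit \<Rightarrow> operator \<Rightarrow> operator" where
  \<comment> \<open>the component of parity \<open>p\<close> of a linear operator\<close>
  "op_comp p D = (\<lambda>a. \<Sum>q\<in>{0, 1}. sl_proj (p + q) (D (sl_proj q a)))"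

definition supercommutator :: "operator \<Rightarrow> operator \<Rightarrow> operator" where
  \<comment> \<open>bilinear extension of \<open>[D,E] = DE - (-1)\<^bsup>p(D)p(E)\<^esup> ED\<close>\<close>
  "supercommutator D E =
     (\<lambda>a. \<Sum>p\<in>{0, 1}. \<Sum>q\<in>{0, 1}.
        op_comp p D (op_comp q E a) - koszul p q * op_comp q E (op_comp p D a))"

definition W2 :: "operator super_lie" where
  "W2 = \<lparr>part = superderivations, scal = op_scal, br = supercommutator\<rparr>"

definition vfield :: "superlaurent \<Rightarrow> superlaurent \<Rightarrow> superlaurent \<Rightarrow> operator" where
  \<comment> \<open>\<open>f \<partial>\<^sub>t + f\<^sub>1 \<partial>\<^sub>1 + f\<^sub>2 \<partial>\<^sub>2\<close>\<close>
  "vfield f f1 f2 = (\<lambda>a. f * d_t a + f1 * d_1 a + f2 * d_2 a)"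

lemma vfield_coordinates:
  \<comment> \<open>so the coefficients of a vector field are determined by the operator\<close>
  "vfield f f1 f2 (tpow 1) = f" "vfield f f1 f2 theta1 = f1" "vfield f f1 f2 theta2 = f2"
  by (simp_all add: vfield_def d_t_def d_1_def d_2_def tpow_def theta1_def theta2_def
      laurent_deriv_def plus_superlaurent_def times_superlaurent_def)

definition Div :: "superlaurent \<Rightarrow> superlaurent \<Rightarrow> superlaurent \<Rightarrow> superlaurent" where
  \<comment> \<open>the divergence of \<open>vfield f f1 f2\<close>\<close>
  "Div f f1 f2 = d_t f + d_1 (sl_sign f1) + d_2 (sl_sign f2)"

definition S20 :: "operator super_lie" where
  "S20 = sub_super_lie W2 {vfield f f1 f2 | f f1 f2. Div f f1 f2 = 0}"

definition S20' :: "operator super_lie" where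
  "S20' = derived_super_lie S20"

definition calL :: "int \<Rightarrow> operator" where
  \<comment> \<open>\<open>-t\<^sup>n (t \<partial>\<^sub>t + (n+1)/2 (\<theta>\<^sub>1 \<partial>\<^sub>1 + \<theta>\<^sub>2 \<partial>\<^sub>2))\<close>\<close>
  "calL n = - vfield (tpow n * tpow 1)
      (const ((of_int n + 1) / 2) * tpow n * theta1)
      (const ((of_int n + 1) / 2) * tpow n * theta2)"

definition Hn :: "int \<Rightarrow> operator" where
  \<comment> \<open>\<open>t\<^sup>n (\<theta>\<^sub>2 \<partial>\<^sub>2 - \<theta>\<^sub>1 \<partial>\<^sub>1)\<close>\<close>
  "Hn n = vfield 0 (- (tpow n * theta1)) (tpow n * theta2)"

definition L0 :: operator where
  "L0 = - calL 0 + op_scal (1 / 2) (Hn 0)"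


section \<open>The superalgebra of classical operators in Kaehler geometry\<close>

text \<open>\<open>KLap\<close> is the Laplacian, and \<open>Kds\<close>, \<open>Kdcs\<close> are the adjoints of \<open>d\<close>, \<open>d\<^sub>c\<close>.\<close>

datatype kgen = KLap | KL | KH | KLam | Kd | Kds | Kdc | Kdcs

lemma UNIV_kgen: "UNIV = {KLap, KL, KH, KLam, Kd, Kds, Kdc, Kdcs}"
  using kgen.exhaust by blast

instance kgen :: finite
  by standard (simp add: UNIV_kgen)

fun kpar :: "kgen \<Rightarrow> bit" where
  "kpar Kd = 1"
| "kpar Kds = 1"
| "kpar Kdc = 1"
| "kpar Kdcs = 1"
| "kpar _ = 0"

abbreviation kv :: "kgen \<Rightarrow> complex ^ kgen" where
  "kv a \<equiv> axis a 1"

text \<open>Each unordered pair of generators occurs at most once in the list of relations.\<close>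

fun krel :: "kgen \<Rightarrow> kgen \<Rightarrow> complex ^ kgen" where
  "krel KL KLam = kv KH"
| "krel KH KL = 2 *s kv KL"
| "krel KH KLam = - (2 *s kv KLam)"
| "krel Kd Kds = kv KLap"
| "krel Kdc Kdcs = kv KLap"
| "krel KH Kd = kv Kd"
| "krel KH Kds = - kv Kds"
| "krel KH Kdc = kv Kdc"
| "krel KH Kdcs = - kv Kdcs"
| "krel KL Kds = - kv Kdc"
| "krel KL Kdcs = kv Kd"
| "krel KLam Kd = kv Kdcs"
| "krel KLam Kdc = - kv Kds"
| "krel _ _ = 0"

definition kbr_gen :: "kgen \<Rightarrow> kgen \<Rightarrow> complex ^ kgen" where
  \<comment> \<open>completion of the listed relations by super skew-symmetry\<close>
  "kbr_gen a b = krel a b - koszul (kpar a) (kpar b) *s krel b a"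

definition kbr :: "complex ^ kgen \<Rightarrow> complex ^ kgen \<Rightarrow> complex ^ kgen" where
  "kbr x y = (\<Sum>a\<in>UNIV. \<Sum>b\<in>UNIV. (x $ a * y $ b) *s kbr_gen a b)"

definition Kaehler :: "(complex ^ kgen) super_lie" where
  "Kaehler = \<lparr>part = \<lambda>p. vec.span {kv a | a. kpar a = p}, scal = (*s), br = kbr\<rparr>"

end

(*
  L_0 = t d/dt + theta_2 d/dtheta_2 gives t and theta_2 the weight 1 and theta_1 the weight 0, so
  the divergence-free vector fields of degree zero form a space of dimension 5|4. Its even part
  contains theta_1 theta_2 d/dt, but the theta_1 theta_2 component of the d/dt coefficient of a
  bracket of divergence-free fields vanishes, so S'(2,0) loses this direction and dimension 4|4
  remains. An explicit linear bijection from the Kaehler superalgebra onto these fields preserves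
  brackets; the Lie superalgebra axioms are verified only for the Kaehler superalgebra, by
  structure constants, and transported along the bijection.
*)
theory Submission
  imports Defs
begin

section \<open>Laurent polynomials and their derivative\<close>

text \<open>Every finitely supported function is a sum of monomials. Identities additive in a
  Laurent polynomial thus need checking on monomials only.\<close>

lemma poly_mapping_additive_induct [case_names zero single add]:
  fixes f :: "'a \<Rightarrow>\<^sub>0 'b::comm_monoid_add"
  assumes "P 0" and "\<And>n c. P (Poly_Mapping.single n c)"
    and add: "\<And>f g. P f \<Longrightarrow> P g \<Longrightarrow> P (f + g)"
  shows "P f"
proof (induction f rule: update_induct)
  case (update f a b)
  have "Poly_Mapping.update a b f = f + Poly_Mapping.single a b"
    using update.hyps
    by (intro poly_mapping_eqI) (auto simp: lookup_update lookup_add lookup_single in_keys_iff)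
  then show ?case using assms update by simp
qed fact

lemma lookup_laurent_deriv:
  "Poly_Mapping.lookup (laurent_deriv f) n = of_int (n + 1) * Poly_Mapping.lookup f (n + 1)"
proof -
  have "Poly_Mapping.lookup (laurent_deriv f) n =
     (\<Sum>m\<in>Poly_Mapping.keys f. if m = n + 1 then of_int m * Poly_Mapping.lookup f m else 0)"
    unfolding laurent_deriv_def lookup_sum
    by (intro sum.cong) (auto simp: lookup_single when_def)
  also have "\<dots> = of_int (n + 1) * Poly_Mapping.lookup f (n + 1)"
    by (auto simp: sum.delta in_keys_iff)
  finally show ?thesis .
qed

lemma laurent_deriv_single [simp]:
  "laurent_deriv (Poly_Mapping.single n c) = Poly_Mapping.single (n - 1) (of_int n * c)"
  by (rule poly_mapping_eqI) (auto simp: lookup_laurent_deriv lookup_single when_def)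

lemma laurent_deriv_add [simp]: "laurent_deriv (f + g) = laurent_deriv f + laurent_deriv g"
  by (rule poly_mapping_eqI) (simp add: lookup_laurent_deriv lookup_add algebra_simps)

lemma laurent_deriv_uminus [simp]: "laurent_deriv (- f) = - laurent_deriv f"
  by (rule poly_mapping_eqI) (simp add: lookup_laurent_deriv)

lemma laurent_deriv_diff [simp]: "laurent_deriv (f - g) = laurent_deriv f - laurent_deriv g"
  by (rule poly_mapping_eqI) (simp add: lookup_laurent_deriv lookup_minus algebra_simps)

lemma laurent_deriv_0 [simp]: "laurent_deriv 0 = 0"
  by (rule poly_mapping_eqI) (simp add: lookup_laurent_deriv)

lemma laurent_deriv_1 [simp]: "laurent_deriv 1 = 0"
  using laurent_deriv_single[of 0 1] by simp

text \<open>Both sides are biadditive, so two nested inductions reduce the product rule to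
  monomials, where it reads \<open>m + n\<close> on exponents.\<close>

lemma laurent_deriv_mult [simp]:
  "laurent_deriv (f * g) = laurent_deriv f * g + f * laurent_deriv g"
proof (induction f rule: poly_mapping_additive_induct)
  case (single m a)
  show ?case
  proof (induction g rule: poly_mapping_additive_induct)
    case (single n b)
    show ?case
      by (simp add: mult_single algebra_simps flip: single_add)
  qed (simp_all add: algebra_simps)
qed (simp_all add: algebra_simps)

text \<open>The Euler operator \<open>t d/dt\<close> multiplies the coefficient at exponent
  \<open>n\<close> by \<open>n\<close>, so an eigenvector for \<open>k\<close> has no coefficient
  away from \<open>k\<close>. This turns the degree condition into a finite-dimensional one.\<close>

lemma euler_eigenvector:
  assumes "Poly_Mapping.single 1 1 * laurent_deriv u = of_int k * u"
  shows "u = Poly_Mapping.single k (Poly_Mapping.lookup u k)"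
proof (rule poly_mapping_eqI)
  fix n
  have shift: "Poly_Mapping.lookup (Poly_Mapping.single m c * f) n = c * Poly_Mapping.lookup f (n - m)"
    for m c and f :: laurent
  proof (induction f rule: poly_mapping_additive_induct)
    case (single i a)
    then show ?case by (auto simp: mult_single lookup_single when_def)
  qed (simp_all add: lookup_add algebra_simps)
  have "of_int n * Poly_Mapping.lookup u n = of_int k * Poly_Mapping.lookup u n"
    using arg_cong[OF assms[folded single_of_int], of "\<lambda>f. Poly_Mapping.lookup f n"]
    by (simp add: shift lookup_laurent_deriv del: single_of_int)
  then show "Poly_Mapping.lookup u n
      = Poly_Mapping.lookup (Poly_Mapping.single k (Poly_Mapping.lookup u k)) n"
    by (auto simp: lookup_single when_def)
qed

section \<open>Vector fields: parity, brackets and divergence\<close>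

lemmas sl_simps = zero_superlaurent_def one_superlaurent_def plus_superlaurent_def
  uminus_superlaurent_def minus_superlaurent_def times_superlaurent_def
  d_t_def d_1_def d_2_def const_def tpow_def theta1_def theta2_def
  sl_proj_def

text \<open>Since \<open>d_t\<close> is even and \<open>d_1\<close>, \<open>d_2\<close> are odd, the
  coefficients of the latter two contribute with shifted parity.\<close>

lemma op_comp_vfield:
  "op_comp p (vfield f f1 f2) = vfield (sl_proj p f) (sl_proj (p + 1) f1) (sl_proj (p + 1) f2)"
  by (cases p) (auto simp: op_comp_def vfield_def sl_simps fun_eq_iff)

lemma vfield_add: "vfield f f1 f2 + vfield g g1 g2 = vfield (f + g) (f1 + g1) (f2 + g2)"
  by (simp add: vfield_def fun_eq_iff algebra_simps)

text \<open>The sign \<open>koszul p q\<close> makes the second-order terms of the two compositions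
  cancel, so a first-order operator remains.\<close>

lemma super_bracket_vfield:
  assumes "f \<in> sl_part p" "f1 \<in> sl_part (p + 1)" "f2 \<in> sl_part (p + 1)"
    and "g \<in> sl_part q" "g1 \<in> sl_part (q + 1)" "g2 \<in> sl_part (q + 1)"
  defines "B \<equiv> \<lambda>a. vfield f f1 f2 (vfield g g1 g2 a) - koszul p q * vfield g g1 g2 (vfield f f1 f2 a)"
  shows "B a = vfield (B (tpow 1)) (B theta1) (B theta2) a"
  using assms(1-6) unfolding B_def
  by (cases p; cases q; cases a) (auto simp: koszul_def vfield_def sl_simps sl_part_def algebra_simps)

text \<open>
  A vector field is determined by its values at \<open>t\<close>, \<open>\<theta>\<^sub>1\<close> and \<open>\<theta>\<^sub>2\<close>, so this reduces every bracket
  computation to these three arguments.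
\<close>

lemma supercommutator_vfield:
  defines "B \<equiv> \<lambda>f f1 f2 g g1 g2. supercommutator (vfield f f1 f2) (vfield g g1 g2)"
  shows "B f f1 f2 g g1 g2 = vfield (B f f1 f2 g g1 g2 (tpow 1))
    (B f f1 f2 g g1 g2 theta1) (B f f1 f2 g g1 g2 theta2)"
proof -
  have proj: "sl_proj p a \<in> sl_part p" for p a
    by (cases p) (auto simp: sl_proj_def sl_part_def)
  \<comment> \<open>\<open>C p q\<close> is the bracket of the components of parities
    \<open>p\<close> and \<open>q\<close>, whose coefficients are homogeneous as
    \<open>super_bracket_vfield\<close> requires.\<close>
  define C where "C p q a =
     vfield (sl_proj p f) (sl_proj (p + 1) f1) (sl_proj (p + 1) f2)
       (vfield (sl_proj q g) (sl_proj (q + 1) g1) (sl_proj (q + 1) g2) a)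
     - koszul p q * vfield (sl_proj q g) (sl_proj (q + 1) g1) (sl_proj (q + 1) g2)
       (vfield (sl_proj p f) (sl_proj (p + 1) f1) (sl_proj (p + 1) f2) a)" for p q a
  have C: "C p q = vfield (C p q (tpow 1)) (C p q theta1) (C p q theta2)" for p q
    unfolding C_def by (rule ext, rule super_bracket_vfield) (rule proj)+
  have B: "B f f1 f2 g g1 g2 = C 0 0 + C 0 1 + C 1 0 + C 1 1"
    by (auto simp: B_def supercommutator_def op_comp_vfield C_def fun_eq_iff)
  show ?thesis
    unfolding B
    by (subst C[of 0 0], subst C[of 0 1], subst C[of 1 0], subst C[of 1 1])
       (simp add: vfield_add)
qed

lemma vector_space_op_scal: "vector_space op_scal"
  by standard (auto simp: op_scal_def fun_eq_iff sl_simps single_add mult_single algebra_simps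
      simp flip: mult.assoc)

lemma sl_part_iff:
  "a \<in> sl_part 0 \<longleftrightarrow> c1 a = 0 \<and> c2 a = 0"
  "a \<in> sl_part 1 \<longleftrightarrow> c0 a = 0 \<and> c12 a = 0"
  by (cases a; auto simp: sl_part_def)+

lemma vfield_superderivation:
  assumes "f \<in> sl_part p" "f1 \<in> sl_part (p + 1)" "f2 \<in> sl_part (p + 1)"
  shows "vfield f f1 f2 \<in> superderivations p"
proof -
  have "vfield f f1 f2 (a * b)
      = vfield f f1 f2 a * b + koszul p q * (a * vfield f f1 f2 b)" if "a \<in> sl_part q" for a b q
    using assms that
    by (cases p; cases q)
      (simp_all add: koszul_def vfield_def sl_simps sl_part_iff algebra_simps)
  moreover have "vfield f f1 f2 a \<in> sl_part (p + q)" if "a \<in> sl_part q" for a q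
    using assms that
    by (cases p; cases q)
      (simp_all add: vfield_def sl_simps sl_part_iff)
  moreover have "vfield f f1 f2 (a + b) = vfield f f1 f2 a + vfield f f1 f2 b"
    "vfield f f1 f2 (const c * a) = const c * vfield f f1 f2 a" for a b c
    by (simp_all add: vfield_def sl_simps algebra_simps)
  ultimately show ?thesis
    unfolding superderivations_def by blast
qed

text \<open>The coefficients are the values at \<open>tpow 1\<close>, which is even, and at
  \<open>theta1\<close> and \<open>theta2\<close>, which are odd; the parity of the operator fixes
  theirs.\<close>

lemma superderivation_coordinates:
  assumes "vfield f f1 f2 \<in> superderivations p"
  shows "f \<in> sl_part p" "f1 \<in> sl_part (p + 1)" "f2 \<in> sl_part (p + 1)"
proof -
  have *: "\<And>q a. a \<in> sl_part q \<Longrightarrow> vfield f f1 f2 a \<in> sl_part (p + q)"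
    using assms by (simp add: superderivations_def)
  show "f \<in> sl_part p" "f1 \<in> sl_part (p + 1)" "f2 \<in> sl_part (p + 1)"
    using *[of "tpow 1" 0] *[of theta1 1] *[of theta2 1]
    by (auto simp: vfield_coordinates) (auto simp: sl_part_def tpow_def theta1_def theta2_def)
qed

lemma Div_add: "Div (f + g) (f1 + g1) (f2 + g2) = Div f f1 f2 + Div g g1 g2"
  by (simp add: Div_def sl_sign_def sl_simps algebra_simps)

text \<open>
  This excludes \<open>\<theta>\<^sub>1\<theta>\<^sub>2 \<partial>\<^sub>t\<close>, which is divergence-free of degree zero, from the derived algebra.
\<close>

lemma c12_supercommutator_eq_0:
  assumes "Div f f1 f2 = 0" "Div g g1 g2 = 0"
  shows "c12 (supercommutator (vfield f f1 f2) (vfield g g1 g2) (tpow 1)) = 0"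
proof -
  obtain u0 u1 u2 u3 a0 a1 a2 a3 b0 b1 b2 b3 where
    f: "f = SL u0 u1 u2 u3" "f1 = SL a0 a1 a2 a3" "f2 = SL b0 b1 b2 b3"
    by (metis superlaurent.exhaust)
  obtain v0 v1 v2 v3 p0 p1 p2 p3 q0 q1 q2 q3 where
    g: "g = SL v0 v1 v2 v3" "g1 = SL p0 p1 p2 p3" "g2 = SL q0 q1 q2 q3"
    by (metis superlaurent.exhaust)
  \<comment> \<open>The four components of each divergence equation, solved for
    coefficients.\<close>
  have eqs: "b2 = laurent_deriv u0 - a1" "b3 = laurent_deriv u1" "a3 = - laurent_deriv u2"
    "laurent_deriv u3 = 0" "q2 = laurent_deriv v0 - p1" "q3 = laurent_deriv v1"
    "p3 = - laurent_deriv v2" "laurent_deriv v3 = 0"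
    using assms by (auto simp: f g Div_def sl_sign_def sl_simps algebra_simps eq_neg_iff_add_eq_0)
  \<comment> \<open>Writing ' for the derivative, the even components of the first field applied to
    those of \<open>g\<close> give \<open>u3 v0' + u0' v3\<close>, symmetric in the two fields, and
    the odd ones give \<open>(u1 v2 - u2 v1)'\<close>, antisymmetric. The commutator kills the
    former and the anticommutator the latter.\<close>
  show ?thesis
    unfolding supercommutator_def op_comp_vfield
    by (simp add: f g koszul_def vfield_def sl_simps) (simp add: eqs algebra_simps)
qed

section \<open>Transport of the superalgebra axioms along a bijection\<close>

text \<open>Each axiom on the carrier of \<open>g\<close> is the image under \<open>\<psi>\<close>
  of the same axiom in \<open>h\<close>. Only the vector space axioms concern the whole ambient type
  of \<open>g\<close>, hence the separate assumption.\<close>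

lemma isomorphic_lie_superalgebrasI:
  fixes g :: "('a::ab_group_add, 'm) super_lie_scheme"
    and h :: "('b::ab_group_add, 'n) super_lie_scheme"
  assumes h: "lie_superalgebra h" and vs: "vector_space (scal g)" and iso: "super_lie_iso \<psi> h g"
  shows "isomorphic_lie_superalgebras g h"
proof -
  interpret h: lie_superalgebra h by fact
  interpret vg: vector_space "scal g" by fact
  interpret vh: vector_space "scal h" by (rule h.vector_space)
  have sub0: "0 \<in> part h p" for p
    using h.subspace_part vh.subspace_0 by blast
  have part_carr: "x \<in> carr h" if "x \<in> part h p" for x p
    using that sub0 unfolding carr_def by (cases p) force+
  have bij: "bij_betw \<psi> (carr h) (carr g)" and parts: "\<psi> ` part h p = part g p"
    and add: "\<lbrakk>x \<in> carr h; y \<in> carr h\<rbrakk> \<Longrightarrow> \<psi> (x + y) = \<psi> x + \<psi> y"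
    and scal: "x \<in> carr h \<Longrightarrow> \<psi> (scal h c x) = scal g c (\<psi> x)"
    and br: "\<lbrakk>x \<in> carr h; y \<in> carr h\<rbrakk> \<Longrightarrow> \<psi> (br h x y) = br g (\<psi> x) (\<psi> y)" for p x y c
    using iso by (auto simp: super_lie_iso_def)
  have carr_g: "carr g = \<psi> ` carr h"
    using bij by (simp add: bij_betw_def)
  have part_g: "part g p = \<psi> ` part h p" for p
    by (simp add: parts)
  have sub: "x + y \<in> part h p" "scal h c x \<in> part h p" if "x \<in> part h p" "y \<in> part h p" for x y p c
    using that h.subspace_part vh.subspace_add vh.subspace_scale by blast+
  have carr_add: "x + y \<in> carr h" if "x \<in> carr h" "y \<in> carr h" for x y
  proof -
    from that obtain a b c d where "x = a + b" "y = c + d" and m: "a \<in> part h 0" "c \<in> part h 0"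
      "b \<in> part h 1" "d \<in> part h 1"
      by (auto simp: carr_def)
    then have "x + y = (a + c) + (b + d)" by (simp add: algebra_simps)
    with m show ?thesis unfolding carr_def using sub by blast
  qed
  have carr_scal: "scal h c x \<in> carr h" if "x \<in> carr h" for x c
  proof -
    from that obtain a b where "x = a + b" "a \<in> part h 0" "b \<in> part h 1"
      by (auto simp: carr_def)
    then show ?thesis
      unfolding carr_def using sub(2) vh.scale_right_distrib by blast
  qed
  \<comment> \<open>Closure is an axiom for homogeneous elements only, so the bracket is expanded
    into its four homogeneous pieces.\<close>
  have carr_br: "br h x y \<in> carr h" if xy: "x \<in> carr h" "y \<in> carr h" for x y
  proof -
    from xy obtain a b c d where "x = a + b" "y = c + d" and m: "a \<in> part h 0" "c \<in> part h 0"
      "b \<in> part h 1" "d \<in> part h 1"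
      by (auto simp: carr_def)
    moreover note carrs = m[THEN part_carr]
    ultimately have "br h x y = (br h a c + br h a d) + (br h b c + br h b d)"
      using carr_add by (simp add: h.br_add_left h.br_add_right)
    then show ?thesis
      using m by (metis carr_add part_carr h.br_closed)
  qed
  have zero: "\<psi> 0 = 0"
    using add[of 0 0] part_carr[OF sub0] by simp
  have minus: "\<psi> (- x) = - \<psi> x" if "x \<in> carr h" for x
    using scal[OF that, of "- 1"] by simp
  note hom = add scal br minus carr_add carr_scal carr_br
  have inj: "x = y" if "\<psi> x = \<psi> y" "x \<in> carr h" "y \<in> carr h" for x y
    using bij that by (auto simp: bij_betw_def inj_on_def)
  have "lie_superalgebra g"
  proof (rule lie_superalgebra.intro)
    show "vg.subspace (part g p)" for p
      unfolding part_g
    proof (rule vg.subspaceI)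
      show "0 \<in> \<psi> ` part h p" using zero sub0 by force
    next
      fix x y assume "x \<in> \<psi> ` part h p" "y \<in> \<psi> ` part h p"
      then obtain a b where "a \<in> part h p" "b \<in> part h p" "x = \<psi> a" "y = \<psi> b" by blast
      then show "x + y \<in> \<psi> ` part h p"
        using sub part_carr by (intro image_eqI[of _ _ "a + b"]) (auto simp: add)
    next
      fix c x assume "x \<in> \<psi> ` part h p"
      then obtain a where "a \<in> part h p" "x = \<psi> a" by blast
      then show "scal g c x \<in> \<psi> ` part h p"
        using sub part_carr by (intro image_eqI[of _ _ "scal h c a"]) (auto simp: scal)
    qed
    have "x = 0" if "x \<in> part g 0" "x \<in> part g 1" for x
    proof -
      obtain a b where ab: "a \<in> part h 0" "b \<in> part h 1" "x = \<psi> a" "x = \<psi> b"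
        using \<open>x \<in> part g 0\<close> \<open>x \<in> part g 1\<close> by (auto simp: part_g)
      then have "a = b" using inj part_carr by metis
      then have "a \<in> part h 0 \<inter> part h 1" using ab by simp
      then show ?thesis using ab zero by (simp add: h.part_Int)
    qed
    moreover have "0 \<in> part g p" for p
      unfolding part_g using zero sub0 by force
    ultimately show "part g 0 \<inter> part g 1 = {0}" by blast
  next
    fix x y p q assume "x \<in> part g p" "y \<in> part g q"
    then obtain a b where ab: "x = \<psi> a" "y = \<psi> b" "a \<in> part h p" "b \<in> part h q"
      by (auto simp: part_g)
    note carrs = ab(3,4)[THEN part_carr]
    show "br g x y \<in> part g (p + q)"
      unfolding part_g ab(1,2) br[OF carrs, symmetric]
      by (rule imageI) (rule h.br_closed[OF ab(3,4)])
    show "br g x y = - scal g (koszul p q) (br g y x)"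
      using arg_cong[OF h.super_skew[OF ab(3,4)], of \<psi>] carrs
      by (simp add: ab(1,2) add scal br minus carr_scal carr_br)
  next
    fix x y z p q r assume "x \<in> part g p" "y \<in> part g q" "z \<in> part g r"
    then obtain a b c where abc: "x = \<psi> a" "y = \<psi> b" "z = \<psi> c"
      "a \<in> part h p" "b \<in> part h q" "c \<in> part h r"
      by (auto simp: part_g)
    note cc = abc(4-6)[THEN part_carr]
    have "\<psi> (br h a (br h b c)) = \<psi> (br h (br h a b) c + scal h (koszul p q) (br h b (br h a c)))"
      by (rule arg_cong[OF h.super_jacobi[OF abc(4-6)]])
    then show "br g x (br g y z) = br g (br g x y) z + scal g (koszul p q) (br g y (br g x z))"
      using cc by (simp add: abc(1-3) hom)
  next
    fix x y z :: 'a and c assume "x \<in> carr g" "y \<in> carr g" "z \<in> carr g"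
    then obtain a b d where abd: "x = \<psi> a" "y = \<psi> b" "z = \<psi> d"
      "a \<in> carr h" "b \<in> carr h" "d \<in> carr h"
      by (auto simp: carr_g)
    show "br g (x + y) z = br g x z + br g y z"
      using arg_cong[OF h.br_add_left[OF abd(4-6)], of \<psi>] by (simp add: abd hom)
    show "br g z (x + y) = br g z x + br g z y"
      using arg_cong[OF h.br_add_right[OF abd(6,4,5)], of \<psi>] by (simp add: abd hom)
    show "br g (scal g c x) y = scal g c (br g x y)"
      using arg_cong[OF h.br_scal_left[OF abd(4,5)], of \<psi>] by (simp add: abd hom)
    show "br g x (scal g c y) = scal g c (br g x y)"
      using arg_cong[OF h.br_scal_right[OF abd(4,5)], of \<psi>] by (simp add: abd hom)
  qed (fact vs)
  moreover have "super_lie_iso (the_inv_into (carr h) \<psi>) g h"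
  proof -
    have inv: "the_inv_into (carr h) \<psi> (\<psi> x) = x" if "x \<in> carr h" for x
      using bij that by (simp add: bij_betw_def the_inv_into_f_f)
    have "the_inv_into (carr h) \<psi> ` part g p = part h p" for p
      unfolding part_g using inv part_carr by (force simp: image_image)
    then show ?thesis
      unfolding super_lie_iso_def
      using bij_betw_the_inv_into[OF bij] inv carr_add carr_scal carr_br
      by (simp add: carr_g flip: add scal br)
  qed
  ultimately show ?thesis
    using h by (auto simp: isomorphic_lie_superalgebras_def)
qed

section \<open>The Kaehler superalgebra in coordinates\<close>

lemma kbr_nth_sum: "kbr x y $ c = (\<Sum>a\<in>UNIV. \<Sum>b\<in>UNIV. x $ a * y $ b * (kbr_gen a b $ c))"
  by (simp add: kbr_def)

text \<open>Explicit bilinear formulas for the bracket, which turn every identity in this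
  superalgebra into polynomial identities in eight coordinates.\<close>

lemma kbr_nth:
  "kbr x y $ KLap = x $ Kd * y $ Kds + x $ Kds * y $ Kd + x $ Kdc * y $ Kdcs + x $ Kdcs * y $ Kdc"
  "kbr x y $ KL = 2 * (x $ KH * y $ KL - x $ KL * y $ KH)"
  "kbr x y $ KH = x $ KL * y $ KLam - x $ KLam * y $ KL"
  "kbr x y $ KLam = 2 * (x $ KLam * y $ KH - x $ KH * y $ KLam)"
  "kbr x y $ Kd = x $ KH * y $ Kd - x $ Kd * y $ KH + x $ KL * y $ Kdcs - x $ Kdcs * y $ KL"
  "kbr x y $ Kds = x $ Kds * y $ KH - x $ KH * y $ Kds + x $ Kdc * y $ KLam - x $ KLam * y $ Kdc"
  "kbr x y $ Kdc = x $ KH * y $ Kdc - x $ Kdc * y $ KH + x $ Kds * y $ KL - x $ KL * y $ Kds"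
  "kbr x y $ Kdcs = x $ Kdcs * y $ KH - x $ KH * y $ Kdcs + x $ KLam * y $ Kd - x $ Kd * y $ KLam"
  by (simp_all add: kbr_nth_sum[unfolded UNIV_kgen] kbr_gen_def koszul_def axis_def)

lemma kgen_all: "(\<forall>a. P a) \<longleftrightarrow> P KLap \<and> P KL \<and> P KH \<and> P KLam \<and> P Kd \<and> P Kds \<and> P Kdc \<and> P Kdcs"
proof (intro iffI allI)
  fix a assume "P KLap \<and> P KL \<and> P KH \<and> P KLam \<and> P Kd \<and> P Kds \<and> P Kdc \<and> P Kdcs"
  then show "P a" by (cases a) simp_all
qed simp

lemmas kgen_vec_eq_iff = vec_eq_iff[where 'b = kgen, unfolded kgen_all]

lemma part_Kaehler: "part Kaehler p = {v. \<forall>a. kpar a \<noteq> p \<longrightarrow> v $ a = 0}"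
proof
  have "vec.subspace {v :: complex ^ kgen. \<forall>a. kpar a \<noteq> p \<longrightarrow> v $ a = 0}"
    by (auto simp: vec.subspace_def)
  then show "part Kaehler p \<subseteq> {v. \<forall>a. kpar a \<noteq> p \<longrightarrow> v $ a = 0}"
    unfolding Kaehler_def super_lie.simps
    by (rule vec.span_minimal[rotated]) (auto simp: axis_def)
next
  show "{v. \<forall>a. kpar a \<noteq> p \<longrightarrow> v $ a = 0} \<subseteq> part Kaehler p"
  proof clarify
    fix v :: "complex ^ kgen" assume v: "\<forall>a. kpar a \<noteq> p \<longrightarrow> v $ a = 0"
    have "(\<Sum>a\<in>UNIV. v $ a *s kv a) \<in> vec.span {kv a | a. kpar a = p}"
    proof (rule vec.span_sum)
      fix a
      show "v $ a *s kv a \<in> vec.span {kv a | a. kpar a = p}"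
        using v by (cases "kpar a = p") (auto intro: vec.span_scale[OF vec.span_base] simp: vec.span_zero)
    qed
    then show "v \<in> part Kaehler p"
      by (simp add: basis_expansion Kaehler_def)
  qed
qed

lemma part_Kaehler_iff:
  "v \<in> part Kaehler 0 \<longleftrightarrow> v $ Kd = 0 \<and> v $ Kds = 0 \<and> v $ Kdc = 0 \<and> v $ Kdcs = 0"
  "v \<in> part Kaehler 1 \<longleftrightarrow> v $ KLap = 0 \<and> v $ KL = 0 \<and> v $ KH = 0 \<and> v $ KLam = 0"
  by (simp_all add: part_Kaehler kgen_all)

lemma carr_Kaehler: "carr Kaehler = UNIV"
proof -
  have "v \<in> carr Kaehler" for v
  proof -
    have "v = (\<chi> a. if kpar a = 0 then v $ a else 0) + (\<chi> a. if kpar a = 0 then 0 else v $ a)"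
      by (simp add: vec_eq_iff)
    then show ?thesis
      unfolding carr_def by (force simp: part_Kaehler)
  qed
  then show ?thesis by blast
qed

lemma scal_Kaehler [simp]: "scal Kaehler = (*s)" and br_Kaehler [simp]: "br Kaehler = kbr"
  by (simp_all add: Kaehler_def)

text \<open>For homogeneous arguments the coordinates of the other parity vanish; what remains of
  each axiom is a polynomial identity, checked coordinate by coordinate.\<close>

lemma lie_superalgebra_Kaehler: "lie_superalgebra Kaehler"
proof (rule lie_superalgebra.intro)
  show "module.subspace (scal Kaehler) (part Kaehler p)" for p
    by (simp add: part_Kaehler vec.subspace_def)
next
  fix x y z p q r
  assume x: "x \<in> part Kaehler p" and y: "y \<in> part Kaehler q" and z: "z \<in> part Kaehler r"
  show "br Kaehler x (br Kaehler y z)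
        = br Kaehler (br Kaehler x y) z + scal Kaehler (koszul p q) (br Kaehler y (br Kaehler x z))"
    using x y z by (cases p; cases q; cases r)
      (simp_all add: part_Kaehler_iff kgen_vec_eq_iff kbr_nth koszul_def algebra_simps)
next
  fix x y p q
  assume x: "x \<in> part Kaehler p" and y: "y \<in> part Kaehler q"
  show "br Kaehler x y \<in> part Kaehler (p + q)"
    using x y by (cases p; cases q) (simp_all add: part_Kaehler_iff kbr_nth)
  show "br Kaehler x y = - scal Kaehler (koszul p q) (br Kaehler y x)"
    using x y by (cases p; cases q)
      (simp_all add: part_Kaehler_iff kgen_vec_eq_iff kbr_nth koszul_def algebra_simps)
next
  show "part Kaehler 0 \<inter> part Kaehler 1 = {0}"
    by (auto simp: part_Kaehler_iff kgen_vec_eq_iff)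
next
  show "vector_space (scal Kaehler)"
    unfolding scal_Kaehler by (rule vec.vector_space_axioms)
next
  fix x y z :: "complex ^ kgen" and c
  show "br Kaehler (x + y) z = br Kaehler x z + br Kaehler y z"
    "br Kaehler x (y + z) = br Kaehler x y + br Kaehler x z"
    "br Kaehler (scal Kaehler c x) y = scal Kaehler c (br Kaehler x y)"
    "br Kaehler x (scal Kaehler c y) = scal Kaehler c (br Kaehler x y)"
    by (simp_all add: kgen_vec_eq_iff kbr_nth algebra_simps)
qed

section \<open>The Kaehler superalgebra realised by vector fields\<close>

text \<open>
  The generators \<open>\<triangle>, L, H, \<Lambda>, d, d\<^sup>*, d\<^sub>c, d\<^sub>c\<^sup>*\<close> go to \<open>L\<^sub>0, E\<^bsub>-1\<^esub>, H\<^sub>0, F\<^sub>1, h\<^sub>0, -p\<^sub>0, x\<^bsub>-1\<^esub>, y\<^sub>1\<close>.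
\<close>

definition kaehler_field :: "complex ^ kgen \<Rightarrow> operator" where
  "kaehler_field v = vfield
     (SL (Poly_Mapping.single 1 (v $ KLap)) (Poly_Mapping.single 1 (v $ Kdcs))
       (Poly_Mapping.single 0 (v $ Kd)) 0)
     (SL (Poly_Mapping.single 0 (v $ Kdc)) (Poly_Mapping.single 0 (- v $ KH))
       (Poly_Mapping.single (- 1) (v $ KL)) 0)
     (SL (Poly_Mapping.single 1 (v $ Kds)) (Poly_Mapping.single 1 (v $ KLam))
       (Poly_Mapping.single 0 (v $ KLap + v $ KH)) (Poly_Mapping.single 0 (v $ Kdcs)))"

lemma kaehler_field_add: "kaehler_field (v + w) = kaehler_field v + kaehler_field w"
  by (simp add: kaehler_field_def vfield_add plus_superlaurent_def algebra_simps flip: single_add)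

lemma op_scal_vfield: "op_scal c (vfield f f1 f2) = vfield (const c * f) (const c * f1) (const c * f2)"
  by (simp add: op_scal_def vfield_def distrib_left mult.assoc)

lemma kaehler_field_scal: "kaehler_field (c *s v) = op_scal c (kaehler_field v)"
  by (simp add: kaehler_field_def op_scal_vfield const_def times_superlaurent_def mult_single
      algebra_simps)

lemma single_eq_single_iff [simp]:
  "Poly_Mapping.single k a = Poly_Mapping.single k b \<longleftrightarrow> a = b"
  by (metis lookup_single_eq)

lemma single_eq_0_iff [simp]: "Poly_Mapping.single k a = 0 \<longleftrightarrow> a = 0"
  using single_eq_single_iff[of k a 0] by simp

lemma vfield_eq_iff: "vfield f f1 f2 = vfield g g1 g2 \<longleftrightarrow> f = g \<and> f1 = g1 \<and> f2 = g2"
  by (metis vfield_coordinates)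

lemma inj_kaehler_field: "inj kaehler_field"
  by (rule injI) (auto simp: kaehler_field_def vfield_eq_iff kgen_vec_eq_iff)

text \<open>The halves of \<open>theta1 d_1\<close> in \<open>- calL 0\<close> and in
  \<open>Hn 0\<close> cancel and those of \<open>theta2 d_2\<close> add up, leaving
  \<open>t d_t + theta2 d_2\<close>.\<close>

lemma L0_eq: "L0 = kaehler_field (kv KLap)"
proof
  fix a
  have half: "2 * Poly_Mapping.single 0 (1 / 2) = (1 :: laurent)"
    by (simp add: mult_2 flip: single_add)
  show "L0 a = kaehler_field (kv KLap) a"
    by (simp add: L0_def calL_def Hn_def kaehler_field_def op_scal_vfield)
       (simp add: half vfield_def sl_simps axis_def mult_single algebra_simps
         flip: single_add distrib_right)
qed

text \<open>Both sides are vector fields, so they agree as soon as they do at \<open>tpow 1\<close>,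
  \<open>theta1\<close> and \<open>theta2\<close>.\<close>

lemma supercommutator_kaehler_field:
  "supercommutator (kaehler_field v) (kaehler_field w) = kaehler_field (kbr v w)"
proof -
  have "supercommutator (kaehler_field v) (kaehler_field w) a = kaehler_field (kbr v w) a"
    if "a \<in> {tpow 1, theta1, theta2}" for a
    using that
    by (auto simp: supercommutator_def kaehler_field_def op_comp_vfield)
       (auto simp: koszul_def vfield_def sl_simps kbr_nth mult_single algebra_simps
         simp flip: single_add single_diff single_uminus)
  note eq = this[unfolded kaehler_field_def]
  show ?thesis
    unfolding kaehler_field_def
    by (subst supercommutator_vfield) (simp add: eq vfield_coordinates)
qed

lemma kaehler_field_superderivation:
  assumes "v \<in> part Kaehler p"
  shows "kaehler_field v \<in> superderivations p"
  using assms unfolding kaehler_field_def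
  by (cases p; intro vfield_superderivation) (auto simp: part_Kaehler_iff sl_part_iff)

text \<open>The coordinates \<open>KLap\<close>, \<open>KH\<close> and \<open>Kdcs\<close> recur in
  the last coefficient precisely so that the divergence cancels.\<close>

lemma Div_kaehler_field: "kaehler_field v \<in> {vfield f f1 f2 | f f1 f2. Div f f1 f2 = 0}"
proof -
  have "Div
     (SL (Poly_Mapping.single 1 (v $ KLap)) (Poly_Mapping.single 1 (v $ Kdcs))
       (Poly_Mapping.single 0 (v $ Kd)) 0)
     (SL (Poly_Mapping.single 0 (v $ Kdc)) (Poly_Mapping.single 0 (- v $ KH))
       (Poly_Mapping.single (- 1) (v $ KL)) 0)
     (SL (Poly_Mapping.single 1 (v $ Kds)) (Poly_Mapping.single 1 (v $ KLam))
       (Poly_Mapping.single 0 (v $ KLap + v $ KH)) (Poly_Mapping.single 0 (v $ Kdcs))) = 0"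
    by (simp add: Div_def sl_sign_def sl_simps single_add single_uminus)
  then show ?thesis
    unfolding kaehler_field_def by blast
qed

section \<open>Divergence-free fields and their derived algebra\<close>

interpretation op: vector_space op_scal
  by (rule vector_space_op_scal)

lemma S20_simps [simp]:
  "part S20 p = superderivations p \<inter> {vfield f f1 f2 | f f1 f2. Div f f1 f2 = 0}"
  "scal S20 = op_scal" "br S20 = supercommutator"
  by (simp_all add: S20_def sub_super_lie_def W2_def)

lemma carr_S20: "D \<in> carr S20 \<Longrightarrow> D \<in> {vfield f f1 f2 | f f1 f2. Div f f1 f2 = 0}"
  by (auto simp: carr_def vfield_add) (metis Div_add add_0_left)

lemma kaehler_field_in_S20: "kaehler_field v \<in> carr S20"
proof -
  have "v \<in> carr Kaehler" by (simp add: carr_Kaehler)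
  then obtain x y where xy: "v = x + y" "x \<in> part Kaehler 0" "y \<in> part Kaehler 1"
    by (auto simp: carr_def)
  then have "kaehler_field x \<in> part S20 0" "kaehler_field y \<in> part S20 1"
    unfolding S20_simps using kaehler_field_superderivation Div_kaehler_field by blast+
  then show ?thesis
    unfolding carr_def xy(1) kaehler_field_add by blast
qed

abbreviation "S20_brackets \<equiv> {supercommutator x y | x y. x \<in> carr S20 \<and> y \<in> carr S20}"

text \<open>The Kaehler superalgebra is perfect: \<open>KL\<close>, \<open>KLam\<close> and the odd
  generators are eigenvectors of \<open>KH\<close> with nonzero eigenvalue, while \<open>KH\<close>
  is the bracket of \<open>KL\<close> with \<open>KLam\<close> and \<open>KLap\<close> that of
  \<open>Kd\<close> with \<open>Kds\<close>.\<close>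

lemma kaehler_field_in_span: "kaehler_field v \<in> op.span S20_brackets"
proof -
  \<comment> \<open>Each coordinate of \<open>v\<close> is divided by its eigenvalue under
    \<open>KH\<close>, which is 2, -2, 1 or -1; the default 0 covers \<open>KH\<close> and
    \<open>KLap\<close>, of eigenvalue 0.\<close>
  define w :: "complex ^ kgen" where
    "w = (\<chi> a. case a of KL \<Rightarrow> v $ KL / 2 | KLam \<Rightarrow> - v $ KLam / 2 | Kd \<Rightarrow> v $ Kd | Kds \<Rightarrow> - v $ Kds
       | Kdc \<Rightarrow> v $ Kdc | Kdcs \<Rightarrow> - v $ Kdcs | _ \<Rightarrow> 0)"
  have "v = kbr (kv KH) w + kbr (kv KL) (axis KLam (v $ KH)) + kbr (kv Kd) (axis Kds (v $ KLap))"
    by (simp add: kgen_vec_eq_iff kbr_nth w_def axis_def)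
  then have "kaehler_field v = supercommutator (kaehler_field (kv KH)) (kaehler_field w)
      + supercommutator (kaehler_field (kv KL)) (kaehler_field (axis KLam (v $ KH)))
      + supercommutator (kaehler_field (kv Kd)) (kaehler_field (axis Kds (v $ KLap)))"
    by (metis kaehler_field_add supercommutator_kaehler_field)
  moreover have "supercommutator (kaehler_field x) (kaehler_field y) \<in> op.span S20_brackets" for x y
    using kaehler_field_in_S20 by (blast intro: op.span_base)
  ultimately show ?thesis
    by (simp only: op.span_add)
qed

text \<open>The condition is linear in \<open>D\<close>, so it passes from single brackets to their
  span.\<close>

lemma c12_span_S20_brackets:
  assumes "D \<in> op.span S20_brackets"
  shows "c12 (D (tpow 1)) = 0"
proof -
  have "op.subspace {D. c12 (D (tpow 1)) = 0}"
    by (rule op.subspaceI) (auto simp: op_scal_def sl_simps)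
  moreover have "S20_brackets \<subseteq> {D. c12 (D (tpow 1)) = 0}"
    using carr_S20 c12_supercommutator_eq_0 by blast
  ultimately show ?thesis
    using op.span_minimal assms by blast
qed

section \<open>The degree zero part\<close>

lemma degree_part_simps [simp]:
  "part (degree_part S20' L0 0) p = superderivations p \<inter> {vfield f f1 f2 | f f1 f2. Div f f1 f2 = 0}
     \<inter> op.span S20_brackets \<inter> {D. supercommutator L0 D = 0}"
  "scal (degree_part S20' L0 0) = op_scal" "br (degree_part S20' L0 0) = supercommutator"
  by (auto simp: degree_part_def S20'_def derived_super_lie_def sub_super_lie_def)

text \<open>\<open>L0\<close> is even, fixes \<open>tpow 1\<close> and \<open>theta2\<close>, and
  kills \<open>theta1\<close>.\<close>

lemma supercommutator_L0_vfield:
  "supercommutator L0 (vfield f f1 f2) (tpow 1) = L0 f - f"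
  "supercommutator L0 (vfield f f1 f2) theta1 = L0 f1"
  "supercommutator L0 (vfield f f1 f2) theta2 = L0 f2 - f2"
  unfolding L0_eq supercommutator_def kaehler_field_def op_comp_vfield
  by (simp_all add: axis_def koszul_def vfield_def sl_simps algebra_simps)

lemma L0_apply:
  "L0 (SL a b c d) = SL (Poly_Mapping.single 1 1 * laurent_deriv a)
     (Poly_Mapping.single 1 1 * laurent_deriv b) (Poly_Mapping.single 1 1 * laurent_deriv c + c)
     (Poly_Mapping.single 1 1 * laurent_deriv d + d)"
  by (simp add: L0_eq kaehler_field_def axis_def vfield_def sl_simps)

text \<open>Of the twelve Laurent coefficients of \<open>D\<close>, membership in the derived
  algebra kills \<open>u3\<close> and degree zero makes the other eleven monomials. The divergence
  then imposes three relations, leaving eight parameters.\<close>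

lemma degree_part_subset:
  assumes "D \<in> part (degree_part S20' L0 0) p"
  obtains v where "v \<in> part Kaehler p" "D = kaehler_field v"
proof -
  obtain u0 u1 u2 u3 a0 a1 a2 a3 b0 b1 b2 b3 where
    D: "D = vfield (SL u0 u1 u2 u3) (SL a0 a1 a2 a3) (SL b0 b1 b2 b3)"
    and Div: "Div (SL u0 u1 u2 u3) (SL a0 a1 a2 a3) (SL b0 b1 b2 b3) = 0"
    using assms by simp (metis superlaurent.exhaust)
  have "u3 = 0"
    using assms c12_span_S20_brackets[of D] by (simp add: D vfield_coordinates)
  have L0: "supercommutator L0 D = 0"
    using assms by simp
  have "L0 (SL u0 u1 u2 u3) = SL u0 u1 u2 u3" "L0 (SL a0 a1 a2 a3) = 0"
    "L0 (SL b0 b1 b2 b3) = SL b0 b1 b2 b3"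
    using supercommutator_L0_vfield[of "SL u0 u1 u2 u3" "SL a0 a1 a2 a3" "SL b0 b1 b2 b3", folded D]
    by (simp_all add: L0)
  \<comment> \<open>The exponent is 1 for \<open>d_t\<close> and \<open>d_2\<close> and 0 for
    \<open>d_1\<close>, lowered by 1 if the component contains \<open>theta2\<close>.\<close>
  then have eigen: "u0 = Poly_Mapping.single 1 (Poly_Mapping.lookup u0 1)"
    "u1 = Poly_Mapping.single 1 (Poly_Mapping.lookup u1 1)"
    "u2 = Poly_Mapping.single 0 (Poly_Mapping.lookup u2 0)"
    "a0 = Poly_Mapping.single 0 (Poly_Mapping.lookup a0 0)"
    "a1 = Poly_Mapping.single 0 (Poly_Mapping.lookup a1 0)"
    "a2 = Poly_Mapping.single (- 1) (Poly_Mapping.lookup a2 (- 1))"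
    "a3 = Poly_Mapping.single (- 1) (Poly_Mapping.lookup a3 (- 1))"
    "b0 = Poly_Mapping.single 1 (Poly_Mapping.lookup b0 1)"
    "b1 = Poly_Mapping.single 1 (Poly_Mapping.lookup b1 1)"
    "b2 = Poly_Mapping.single 0 (Poly_Mapping.lookup b2 0)"
    "b3 = Poly_Mapping.single 0 (Poly_Mapping.lookup b3 0)"
    by - (rule euler_eigenvector; simp add: L0_apply zero_superlaurent_def eq_neg_iff_add_eq_0)+
  obtain lu0 lu1 lu2 la0 la1 la2 la3 lb0 lb1 lb2 lb3 where
    singles: "u0 = Poly_Mapping.single 1 lu0" "u1 = Poly_Mapping.single 1 lu1"
    "u2 = Poly_Mapping.single 0 lu2" "a0 = Poly_Mapping.single 0 la0"
    "a1 = Poly_Mapping.single 0 la1" "a2 = Poly_Mapping.single (- 1) la2"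
    "a3 = Poly_Mapping.single (- 1) la3" "b0 = Poly_Mapping.single 1 lb0"
    "b1 = Poly_Mapping.single 1 lb1" "b2 = Poly_Mapping.single 0 lb2"
    "b3 = Poly_Mapping.single 0 lb3"
    using eigen by blast
  have "laurent_deriv u0 - a1 - b2 = 0" "laurent_deriv u1 - b3 = 0" "laurent_deriv u2 + a3 = 0"
    using Div by (simp_all add: Div_def sl_sign_def sl_simps algebra_simps)
  then have eqs: "lb2 = lu0 - la1" "lb3 = lu1" "la3 = 0"
    by (simp_all add: singles flip: single_diff)
  \<comment> \<open>Coordinates read off from \<open>kaehler_field\<close>, whose
    \<open>theta1 d_1\<close> coefficient is minus the \<open>KH\<close> coordinate.\<close>
  define v :: "complex ^ kgen" where
    "v = (\<chi> a. case a of KLap \<Rightarrow> lu0 | KL \<Rightarrow> la2 | KH \<Rightarrow> - la1 | KLam \<Rightarrow> lb1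
       | Kd \<Rightarrow> lu2 | Kds \<Rightarrow> lb0 | Kdc \<Rightarrow> la0 | Kdcs \<Rightarrow> lu1)"
  have "D = kaehler_field v"
    by (simp add: D kaehler_field_def v_def singles eqs \<open>u3 = 0\<close>)
  moreover have "v \<in> part Kaehler p"
  proof -
    have "D \<in> superderivations p" using assms by simp
    from superderivation_coordinates[OF this[unfolded D]] show ?thesis
      by (cases p) (auto simp: sl_part_iff part_Kaehler_iff v_def singles eqs)
  qed
  ultimately show ?thesis
    using that by blast
qed

theorem theorem6p3:
  shows "isomorphic_lie_superalgebras (degree_part S20' L0 0) Kaehler"
proof (rule isomorphic_lie_superalgebrasI[OF lie_superalgebra_Kaehler])
  let ?g = "degree_part S20' L0 0"
  show "vector_space (scal ?g)"
    by (simp add: vector_space_op_scal)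
  \<comment> \<open>The Laplacian is central and corresponds to \<open>L0\<close>, so every field in
    the image has degree zero.\<close>
  have central: "supercommutator L0 (kaehler_field v) = 0" for v
  proof -
    have "kbr (kv KLap) v = 0"
      by (simp add: kgen_vec_eq_iff kbr_nth axis_def)
    moreover have "kaehler_field 0 = 0"
      using kaehler_field_add[of 0 0] by simp
    ultimately show ?thesis
      by (simp add: L0_eq supercommutator_kaehler_field)
  qed
  have parts: "kaehler_field ` part Kaehler p = part ?g p" for p
  proof
    show "kaehler_field ` part Kaehler p \<subseteq> part ?g p"
      unfolding degree_part_simps
      using kaehler_field_superderivation Div_kaehler_field kaehler_field_in_span central by blast
    show "part ?g p \<subseteq> kaehler_field ` part Kaehler p"
      by (blast elim: degree_part_subset)
  qed
  have "carr ?g = {kaehler_field x + kaehler_field y | x y. x \<in> part Kaehler 0 \<and> y \<in> part Kaehler 1}"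
    unfolding carr_def parts[symmetric] by blast
  also have "\<dots> = kaehler_field ` carr Kaehler"
    unfolding carr_def kaehler_field_add[symmetric] by blast
  finally have "carr ?g = kaehler_field ` carr Kaehler" .
  then have "bij_betw kaehler_field (carr Kaehler) (carr ?g)"
    using inj_kaehler_field by (simp only: carr_Kaehler bij_betw_def)
  then show "super_lie_iso kaehler_field Kaehler ?g"
    unfolding super_lie_iso_def
    by (simp only: parts kaehler_field_add kaehler_field_scal supercommutator_kaehler_field
        scal_Kaehler br_Kaehler degree_part_simps(2,3)) blast
qed

end
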